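(* Let $t$ be a transformation of the frames $(I_0,I_1,\lambda)$ and $(J_0,J_1,\kappa)$, and let $\mathbf G$ be an integral residuated lattice. Then the mapping $\mathcal K(t)\colon K^\kappa_{J_0,J_1}(\mathbf G)\to K^\lambda_{I_0,I_1}(\mathbf G)$ defined by $$\mathcal K(t)(\langle x_i: i\in J_n\rangle)=\langle x_{t(i)}: i\in I_n\rangle\qquad(n\in\mathbb N)$$ is a homomorphism of residuated lattices.
   Context: $\mathbb N=\{0,1,2,\dots\}$. A residuated lattice is an algebra $\mathbf G=(G;\wedge,\vee,\cdot,\backslash,/,e)$ such that $(G;\wedge,\vee)$ is a lattice, $(G;\cdot,e)$ is a monoid, and $x\cdot y\le z$ iff $y\le x\backslash z$ iff $x\le z/y$ for all $x,y,z\in G$. It is integral if $x\le e$ for all $x\in G$. Homomorphisms preserve all of $\wedge,\vee$, product, both divisions and the unit. A frame is a triple $(I_0,I_1,\lambda)$ where $I_1\subseteq I_0$ are sets and $\lambda\colon I_1\to I_0$ is injective. For $n\ge1$ put $I_{n+1}=\{i\in I_n: \lambda(i)\in I_n\}$, and similarly $J_{n+1}=\{j\in J_n:\kappa(j)\in J_n\}$ for a frame $(J_0,J_1,\kappa)$. A transformation of the frames $(I_0,I_1,\lambda)$ and $(J_0,J_1,\kappa)$ is a mapping $t\colon I_0\to J_0$ such that: (1) $t^{-1}(J_1)=I_1$; (2) $t^{-1}(\kappa(J_1))=\lambda(I_1)$; (3) $t(\lambda(i))=\kappa(t(i))$ for every $i\in I_1$. (For such $t$ one has $t(I_n)\subseteq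 J_n$ for every $n$, so the formula for $\mathcal K(t)$ makes sense.) The kite $K^\lambda_{I_0,I_1}(\mathbf G)$ of a frame $(I_0,I_1,\lambda)$ is the following integral residuated lattice. The map $\lambda^{m-n}\colon I_m\to I_n$ is well defined and injective for $n\le m$; $\lambda^{-m}$ denotes the inverse of $\lambda^m$ on its image. The universe is the disjoint union $\biguplus_{n\in\mathbb N}G^{I_n}$ (different $n$ always give disjoint parts; if $I_n=\emptyset$, $G^{I_n}$ is a singleton), with elements written $\langle x_i: i\in I_n\rangle$. Order: $\langle x_i: i\in I_n\rangle\le\langle y_i: i\in I_m\rangle$ iff $m<n$, or $m=n$ and $x_i\le y_i$ for all $i\in I_n$. Unit: $1\in G^{I_0}$ with all coordinates $e$. Product: $\langle x_i: i\in I_m\rangle\cdot\langle y_i: i\in I_n\rangle=\langle x_{\lambda^n(i)}y_i: i\in I_{m+n}\rangle$. Right division: $\langle y_i: i\in I_n\rangle/\!/\langle x_i: i\in I_m\rangle$ is $1$ if $m>n$; if $m\le n$ it is the element of $G^{I_{n-m}}$ with $i$-th coordinate $y_{\lambda^{-m}(i)}/x_{\lambda^{-m}(i)}$ if $i\in\lambda^m(I_n)$ and $e$ otherwise. Left division: $\langle y_i: i\in I_n\rangle\backslash\!\backslash\langle x_i: i\in I_m\rangle$ is $1$ if $n>m$; if $n\le m$ it is the element of $G^{I_{m-n}}$ with $i$-th coordinate $y_{\lambda^{m-n}(i)}\backslash x_i$ if $i\in I_m$ and $e$ otherwise. *)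

theory Defs
  imports "HOL-Algebra.Group" "HOL-Algebra.Lattice"
begin

text \<open>
  The lattice part of a residuated lattice is given by its order; the operations
  \<open>\<sqinter>\<close> and \<open>\<squnion>\<close> are the binary meet and join that HOL-Algebra derives
  from that order. Conventions: \<open>ldiv G x z\<close> is $x \backslash z$ and
  \<open>rdiv G z y\<close> is $z / y$.
\<close>

record 'a residuated = "'a gorder" +
  rmult :: "'a \<Rightarrow> 'a \<Rightarrow> 'a" (infixl "\<odot>\<index>" 70)
  ldiv :: "'a \<Rightarrow> 'a \<Rightarrow> 'a"
  rdiv :: "'a \<Rightarrow> 'a \<Rightarrow> 'a"
  runit :: 'a

locale residuated_lattice = lattice G for G (structure) +
  assumes monoid: "monoid \<lparr>carrier = carrier G, mult = rmult G, one = runit G\<rparr>"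
    and ldiv_closed: "\<lbrakk>x \<in> carrier G; z \<in> carrier G\<rbrakk> \<Longrightarrow> ldiv G x z \<in> carrier G"
    and rdiv_closed: "\<lbrakk>z \<in> carrier G; y \<in> carrier G\<rbrakk> \<Longrightarrow> rdiv G z y \<in> carrier G"
    and residuation_left:
      "\<lbrakk>x \<in> carrier G; y \<in> carrier G; z \<in> carrier G\<rbrakk>
        \<Longrightarrow> x \<odot> y \<sqsubseteq> z \<longleftrightarrow> y \<sqsubseteq> ldiv G x z"
    and residuation_right:
      "\<lbrakk>x \<in> carrier G; y \<in> carrier G; z \<in> carrier G\<rbrakk>
        \<Longrightarrow> x \<odot> y \<sqsubseteq> z \<longleftrightarrow> x \<sqsubseteq> rdiv G z y"

locale integral_residuated_lattice = residuated_lattice +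
  assumes integral: "x \<in> carrier G \<Longrightarrow> x \<sqsubseteq> runit G"

locale residuated_lattice_hom =
  A: residuated_lattice A + B: residuated_lattice B
  for A :: "('a, 'c) residuated_scheme" and B :: "('b, 'd) residuated_scheme" +
  fixes h :: "'a \<Rightarrow> 'b"
  assumes hom_closed: "h \<in> carrier A \<rightarrow> carrier B"
    and hom_meet: "\<lbrakk>x \<in> carrier A; y \<in> carrier A\<rbrakk> \<Longrightarrow> h (x \<sqinter>\<^bsub>A\<^esub> y) = h x \<sqinter>\<^bsub>B\<^esub> h y"
    and hom_join: "\<lbrakk>x \<in> carrier A; y \<in> carrier A\<rbrakk> \<Longrightarrow> h (x \<squnion>\<^bsub>A\<^esub> y) = h x \<squnion>\<^bsub>B\<^esub> h y"
    and hom_mult: "\<lbrakk>x \<in> carrier A; y \<in> carrier A\<rbrakk> \<Longrightarrow> h (x \<odot>\<^bsub>A\<^esub> y) = h x \<odot>\<^bsub>B\<^esub> h y"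
    and hom_ldiv: "\<lbrakk>x \<in> carrier A; y \<in> carrier A\<rbrakk> \<Longrightarrow> h (ldiv A x y) = ldiv B (h x) (h y)"
    and hom_rdiv: "\<lbrakk>x \<in> carrier A; y \<in> carrier A\<rbrakk> \<Longrightarrow> h (rdiv A x y) = rdiv B (h x) (h y)"
    and hom_unit: "h (runit A) = runit B"

text \<open>The map \<open>lam\<close> of a frame is a total HOL function; only its values on \<open>I1\<close> matter.\<close>

locale frame =
  fixes I0 :: "'i set" and I1 :: "'i set" and lam :: "'i \<Rightarrow> 'i"
  assumes subset: "I1 \<subseteq> I0"
    and maps: "lam \<in> I1 \<rightarrow> I0"
    and inj: "inj_on lam I1"

fun level :: "'i set \<Rightarrow> 'i set \<Rightarrow> ('i \<Rightarrow> 'i) \<Rightarrow> nat \<Rightarrow> 'i set" where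
  "level I0 I1 lam 0 = I0"
| "level I0 I1 lam (Suc 0) = I1"
| "level I0 I1 lam (Suc (Suc n)) =
     {i \<in> level I0 I1 lam (Suc n). lam i \<in> level I0 I1 lam (Suc n)}"

locale frame_transformation =
  I: frame I0 I1 lam + J: frame J0 J1 kappa
  for I0 :: "'i set" and I1 lam and J0 :: "'j set" and J1 kappa +
  fixes t :: "'i \<Rightarrow> 'j"
  assumes maps: "t \<in> I0 \<rightarrow> J0"
    and vimage_domain: "{i \<in> I0. t i \<in> J1} = I1"
    and vimage_image: "{i \<in> I0. t i \<in> kappa ` J1} = lam ` I1"
    and commute: "i \<in> I1 \<Longrightarrow> t (lam i) = kappa (t i)"

text \<open>
  An element of the kite is a pair \<open>(n, x)\<close> whose second component is a family indexed by
  the set $I_n$, that is, a function that is \<open>undefined\<close> outside of that set; the tag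
  \<open>n\<close> makes the union over all \<open>n\<close> disjoint.
\<close>

definition kite_unit :: "'i set \<Rightarrow> ('a, 'c) residuated_scheme \<Rightarrow> nat \<times> ('i \<Rightarrow> 'a)" where
  "kite_unit I0 G = (0, \<lambda>i\<in>I0. runit G)"

definition kite_le ::
  "'i set \<Rightarrow> 'i set \<Rightarrow> ('i \<Rightarrow> 'i) \<Rightarrow> ('a, 'c) residuated_scheme \<Rightarrow>
   nat \<times> ('i \<Rightarrow> 'a) \<Rightarrow> nat \<times> ('i \<Rightarrow> 'a) \<Rightarrow> bool" where
  "kite_le I0 I1 lam G = (\<lambda>(n, x) (m, y).
     m < n \<or> (m = n \<and> (\<forall>i\<in>level I0 I1 lam n. x i \<sqsubseteq>\<^bsub>G\<^esub> y i)))"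

definition kite_mult ::
  "'i set \<Rightarrow> 'i set \<Rightarrow> ('i \<Rightarrow> 'i) \<Rightarrow> ('a, 'c) residuated_scheme \<Rightarrow>
   nat \<times> ('i \<Rightarrow> 'a) \<Rightarrow> nat \<times> ('i \<Rightarrow> 'a) \<Rightarrow> nat \<times> ('i \<Rightarrow> 'a)" where
  "kite_mult I0 I1 lam G = (\<lambda>(m, x) (n, y).
     (m + n, \<lambda>i\<in>level I0 I1 lam (m + n). x ((lam ^^ n) i) \<odot>\<^bsub>G\<^esub> y i))"

text \<open>
  In the right division, $\lambda^{-m}$ is the inverse of the injective map
  $\lambda^m \colon I_m \to I_0$.
\<close>

definition kite_rdiv ::
  "'i set \<Rightarrow> 'i set \<Rightarrow> ('i \<Rightarrow> 'i) \<Rightarrow> ('a, 'c) residuated_scheme \<Rightarrow>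
   nat \<times> ('i \<Rightarrow> 'a) \<Rightarrow> nat \<times> ('i \<Rightarrow> 'a) \<Rightarrow> nat \<times> ('i \<Rightarrow> 'a)" where
  "kite_rdiv I0 I1 lam G = (\<lambda>(n, y) (m, x).
     if m > n then kite_unit I0 G
     else (n - m, \<lambda>i\<in>level I0 I1 lam (n - m).
       if i \<in> (lam ^^ m) ` level I0 I1 lam n
       then rdiv G (y (inv_into (level I0 I1 lam m) (lam ^^ m) i))
                   (x (inv_into (level I0 I1 lam m) (lam ^^ m) i))
       else runit G))"

definition kite_ldiv ::
  "'i set \<Rightarrow> 'i set \<Rightarrow> ('i \<Rightarrow> 'i) \<Rightarrow> ('a, 'c) residuated_scheme \<Rightarrow>
   nat \<times> ('i \<Rightarrow> 'a) \<Rightarrow> nat \<times> ('i \<Rightarrow> 'a) \<Rightarrow> nat \<times> ('i \<Rightarrow> 'a)" where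
  "kite_ldiv I0 I1 lam G = (\<lambda>(n, y) (m, x).
     if n > m then kite_unit I0 G
     else (m - n, \<lambda>i\<in>level I0 I1 lam (m - n).
       if i \<in> level I0 I1 lam m
       then ldiv G (y ((lam ^^ (m - n)) i)) (x i)
       else runit G))"

definition kite ::
  "'i set \<Rightarrow> 'i set \<Rightarrow> ('i \<Rightarrow> 'i) \<Rightarrow> ('a, 'c) residuated_scheme \<Rightarrow>
   (nat \<times> ('i \<Rightarrow> 'a)) residuated" where
  "kite I0 I1 lam G = \<lparr>
     carrier = (SIGMA n:UNIV. level I0 I1 lam n \<rightarrow>\<^sub>E carrier G),
     eq = (=),
     le = kite_le I0 I1 lam G,
     rmult = kite_mult I0 I1 lam G,
     ldiv = kite_ldiv I0 I1 lam G,
     rdiv = kite_rdiv I0 I1 lam G,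
     runit = kite_unit I0 G\<rparr>"

definition kite_map ::
  "'i set \<Rightarrow> 'i set \<Rightarrow> ('i \<Rightarrow> 'i) \<Rightarrow> ('i \<Rightarrow> 'j) \<Rightarrow>
   nat \<times> ('j \<Rightarrow> 'a) \<Rightarrow> nat \<times> ('i \<Rightarrow> 'a)" where
  "kite_map I0 I1 lam t = (\<lambda>(n, x). (n, \<lambda>i\<in>level I0 I1 lam n. x (t i)))"

end

theory Submission
  imports Defs
begin

text \<open>
  Everything rests on reading the levels of a frame as orbit conditions: for $i \in I_0$,
  $i \in I_n$ means that $i, \lambda(i), \dots, \lambda^{n-1}(i)$ all lie in $I_1$, so that \<open>\<lambda>\<close> can be applied \<open>n\<close> times
  starting from \<open>i\<close>. Hence $i \in I_{m+n}$ iff $i \in I_n$ and $\lambda^n(i) \in I_m$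
  (\<open>in_level_add_iff\<close>), which is exactly what the product and the divisions of a kite need in
  order to be defined.

  The kite is a residuated lattice because its layers $G^{I_n}$ are stacked downwards as \<open>n\<close>
  grows: elements of different layers are comparable, so meets and joins are either trivial or
  computed coordinatewise. In the residuation law, the product of layers \<open>m\<close> and \<open>n\<close> lies in
  layer $m + n$, so comparing it with layer \<open>p\<close> is decided by the layers alone unless
  $p = m + n$. In that case the law of \<open>G\<close> applies at each $i \in I_p$; the left factor is read at
  $\lambda^n(i)$, and injectivity of $\lambda^n$ lets the right division recover \<open>i\<close>. The
  coordinates of a quotient that no $i \in I_p$ reaches are \<open>e\<close>, and the constraint there is
  void by integrality.

  A transformation \<open>t\<close> commutes with the iterates of \<open>\<lambda>\<close> and \<open>\<kappa>\<close>, and because it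
  preserves and reflects membership in the domains, it does so for every level
  (\<open>in_level_iff\<close>). This gives the unit, the lattice operations, the product and the left
  division. The right division distinguishes whether an index lies in $\lambda^m(I_n)$, so \<open>t\<close>
  must also reflect $\kappa^m(J_n)$. The condition $t^{-1}(\kappa(J_1)) = \lambda(I_1)$ together with injectivity of
  \<open>\<kappa>\<close> allows a backward \<open>\<kappa>\<close>-orbit of $t(i)$ to be lifted step by step to a
  backward \<open>\<lambda>\<close>-orbit of \<open>i\<close> (\<open>lift_funpow_preimage\<close>).
\<close>

section \<open>Frames\<close>

context frame
begin

abbreviation lev :: "nat \<Rightarrow> 'i set" where
  "lev \<equiv> level I0 I1 lam"

text \<open>
  Since \<open>lam\<close> maps \<open>I1\<close> into \<open>I0\<close> only, the recursion asks each time whether one more step is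
  possible; it unfolds to the statement that the first \<open>n\<close> steps are.
\<close>

lemma in_level_iff: "i \<in> lev n \<longleftrightarrow> i \<in> I0 \<and> (\<forall>k<n. (lam ^^ k) i \<in> I1)"
proof (induction n arbitrary: i rule: less_induct)
  case (less n)
  consider "n = 0" | "n = 1" | m where "n = Suc (Suc m)"
    by (metis One_nat_def not0_implies_Suc)
  then show ?case
  proof cases
    case 3
    have step: "(\<forall>k<Suc (Suc m). P k) \<longleftrightarrow> (\<forall>k<Suc m. P k) \<and> (\<forall>k<Suc m. P (Suc k))"
      for P :: "nat \<Rightarrow> bool"
      by (metis Suc_less_eq less_Suc_eq_0_disj less_SucI)
    have "i \<in> lev n \<longleftrightarrow> (i \<in> I0 \<and> (\<forall>k<Suc m. (lam ^^ k) i \<in> I1)) \<and>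
        (lam i \<in> I0 \<and> (\<forall>k<Suc m. (lam ^^ k) (lam i) \<in> I1))"
      using less.IH[of "Suc m"] 3 by simp
    also have "\<dots> \<longleftrightarrow> i \<in> I0 \<and> (\<forall>k<n. (lam ^^ k) i \<in> I1)"
    proof -
      have "lam i \<in> I0" if "(lam ^^ 0) i \<in> I1"
        using that maps by auto
      then show ?thesis
        unfolding 3 step[of "\<lambda>k. (lam ^^ k) i \<in> I1"] by (auto simp: funpow_swap1)
    qed
    finally show ?thesis .
  qed (use subset in auto)
qed

lemma funpow_in_base: "i \<in> lev n \<Longrightarrow> (lam ^^ n) i \<in> I0"
  using maps by (cases n) (auto simp: in_level_iff)

text \<open>
  The first $m + n$ steps are the first \<open>n\<close> steps followed by \<open>m\<close> steps from the point
  reached. For $m = 0$ this includes that the point reached lies in \<open>I0\<close>.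
\<close>

lemma in_level_add_iff: "i \<in> lev (m + n) \<longleftrightarrow> i \<in> lev n \<and> (lam ^^ n) i \<in> lev m"
proof -
  have "(\<forall>k<m + n. P k) \<longleftrightarrow> (\<forall>k<n. P k) \<and> (\<forall>k<m. P (k + n))" for P :: "nat \<Rightarrow> bool"
  proof -
    have "P k" if "\<forall>k<n. P k" "\<forall>k<m. P (k + n)" "k < m + n" for k
      using that(1) that(2)[rule_format, of "k - n"] that(3) by (cases "k < n") auto
    then show ?thesis
      by auto
  qed
  then show ?thesis
    using funpow_in_base[of i n] by (auto simp: in_level_iff funpow_add)
qed

lemma level_antimono: "m \<le> n \<Longrightarrow> lev n \<subseteq> lev m"
  by (auto simp: in_level_iff)

lemma funpow_in_level_diff:
  assumes "m \<le> n" and "i \<in> lev n"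
  shows "(lam ^^ m) i \<in> lev (n - m)"
  using assms in_level_add_iff[of i "n - m" m] by simp

lemma inj_on_funpow: "inj_on (lam ^^ n) (lev n)"
proof (induction n)
  case (Suc n)
  show ?case
  proof (rule inj_onI)
    fix i j
    assume ij: "i \<in> lev (Suc n)" "j \<in> lev (Suc n)" "(lam ^^ Suc n) i = (lam ^^ Suc n) j"
    then have "(lam ^^ n) i = (lam ^^ n) j"
      using inj by (auto simp: in_level_iff dest: inj_onD)
    then show "i = j"
      using Suc ij level_antimono[of n "Suc n"] by (auto dest: inj_onD)
  qed
qed auto

lemma inv_into_funpow:
  assumes "m \<le> n" and "i \<in> lev n"
  shows "inv_into (lev m) (lam ^^ m) ((lam ^^ m) i) = i"
  using assms level_antimono inj_on_funpow by (blast intro: inv_into_f_f)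

end

section \<open>The kite is a residuated lattice\<close>

definition kite_join ::
  "'i set \<Rightarrow> 'i set \<Rightarrow> ('i \<Rightarrow> 'i) \<Rightarrow> ('a, 'c) residuated_scheme \<Rightarrow>
   nat \<times> ('i \<Rightarrow> 'a) \<Rightarrow> nat \<times> ('i \<Rightarrow> 'a) \<Rightarrow> nat \<times> ('i \<Rightarrow> 'a)" where
  "kite_join I0 I1 lam G = (\<lambda>(m, x) (n, y).
     if m < n then (m, x) else if n < m then (n, y)
     else (n, \<lambda>i\<in>level I0 I1 lam n. x i \<squnion>\<^bsub>G\<^esub> y i))"

definition kite_meet ::
  "'i set \<Rightarrow> 'i set \<Rightarrow> ('i \<Rightarrow> 'i) \<Rightarrow> ('a, 'c) residuated_scheme \<Rightarrow>
   nat \<times> ('i \<Rightarrow> 'a) \<Rightarrow> nat \<times> ('i \<Rightarrow> 'a) \<Rightarrow> nat \<times> ('i \<Rightarrow> 'a)" where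
  "kite_meet I0 I1 lam G = (\<lambda>(m, x) (n, y).
     if m < n then (n, y) else if n < m then (m, x)
     else (n, \<lambda>i\<in>level I0 I1 lam n. x i \<sqinter>\<^bsub>G\<^esub> y i))"

lemma (in residuated_lattice) mult_closed:
  "\<lbrakk>x \<in> carrier G; y \<in> carrier G\<rbrakk> \<Longrightarrow> x \<odot> y \<in> carrier G"
  using monoid.m_closed[OF monoid] by simp

lemma (in residuated_lattice) mult_assoc:
  "\<lbrakk>x \<in> carrier G; y \<in> carrier G; z \<in> carrier G\<rbrakk> \<Longrightarrow> x \<odot> y \<odot> z = x \<odot> (y \<odot> z)"
  using monoid.m_assoc[OF monoid] by simp

lemma (in residuated_lattice) unit_closed: "runit G \<in> carrier G"
  using monoid.one_closed[OF monoid] by simp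

lemma (in residuated_lattice) unit_mult: "x \<in> carrier G \<Longrightarrow> runit G \<odot> x = x"
  using monoid.l_one[OF monoid] by simp

lemma (in residuated_lattice) mult_unit: "x \<in> carrier G \<Longrightarrow> x \<odot> runit G = x"
  using monoid.r_one[OF monoid] by simp

locale kite_of_frame = frame I0 I1 lam + G: integral_residuated_lattice G
  for I0 :: "'i set" and I1 lam and G :: "('a, 'c) residuated_scheme" (structure)
begin

abbreviation K :: "(nat \<times> ('i \<Rightarrow> 'a)) residuated" where
  "K \<equiv> kite I0 I1 lam G"

lemma in_carrier_iff: "(n, x) \<in> carrier K \<longleftrightarrow> x \<in> lev n \<rightarrow>\<^sub>E carrier G"
  by (auto simp: kite_def)

lemma le_iff:
  "(m, x) \<sqsubseteq>\<^bsub>K\<^esub> (n, y) \<longleftrightarrow> n < m \<or> m = n \<and> (\<forall>i\<in>lev n. x i \<sqsubseteq> y i)"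
  by (auto simp: kite_def kite_le_def)

lemma partial_order: "partial_order K"
proof
  fix a b assume ab: "a \<sqsubseteq>\<^bsub>K\<^esub> b" "b \<sqsubseteq>\<^bsub>K\<^esub> a" "a \<in> carrier K" "b \<in> carrier K"
  obtain m x n y where [simp]: "a = (m, x)" "b = (n, y)"
    by (metis surj_pair)
  have "x i = y i" if "i \<in> lev n" for i
    using that ab by (intro G.le_antisym) (auto simp: in_carrier_iff le_iff)
  then have "x = y"
    using ab by (intro PiE_ext[of x "lev n" "\<lambda>_. carrier G" y])
      (auto simp: in_carrier_iff le_iff)
  moreover have "m = n"
    using ab by (auto simp: le_iff)
  ultimately show "a .=\<^bsub>K\<^esub> b"
    by (simp add: kite_def)
next
  fix a b c assume abc: "a \<sqsubseteq>\<^bsub>K\<^esub> b" "b \<sqsubseteq>\<^bsub>K\<^esub> c" "a \<in> carrier K" "b \<in> carrier K" "c \<in> carrier K"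
  obtain l x m y n z where [simp]: "a = (l, x)" "b = (m, y)" "c = (n, z)"
    by (metis surj_pair)
  have "x i \<sqsubseteq> z i" if "l = m" "m = n" "i \<in> lev n" for i
    using that abc G.le_trans[of "x i" "y i" "z i"] by (simp add: in_carrier_iff le_iff PiE_iff)
  then show "a \<sqsubseteq>\<^bsub>K\<^esub> c"
    using abc by (auto simp: le_iff)
qed (auto simp: kite_def kite_le_def PiE_iff)

lemma kite_join_closed:
  "\<lbrakk>a \<in> carrier K; b \<in> carrier K\<rbrakk> \<Longrightarrow> kite_join I0 I1 lam G a b \<in> carrier K"
  by (cases a; cases b) (auto simp: in_carrier_iff kite_join_def PiE_iff)

lemma kite_meet_closed:
  "\<lbrakk>a \<in> carrier K; b \<in> carrier K\<rbrakk> \<Longrightarrow> kite_meet I0 I1 lam G a b \<in> carrier K"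
  by (cases a; cases b) (auto simp: in_carrier_iff kite_meet_def PiE_iff)

text \<open>
  Within a layer the bound is the coordinatewise one. An upper bound of two elements of the same
  layer is in that layer or in a higher one, so no other layer can supply a smaller bound.
\<close>

lemma kite_join_is_lub:
  assumes "a \<in> carrier K" and "b \<in> carrier K"
  shows "least K (kite_join I0 I1 lam G a b) (Upper K {a, b})"
proof (rule least_UpperI)
  obtain m x n y where [simp]: "a = (m, x)" "b = (n, y)"
    by (metis surj_pair)
  show "c \<sqsubseteq>\<^bsub>K\<^esub> kite_join I0 I1 lam G a b" if "c \<in> {a, b}" for c
    using that assms
    by (auto simp: kite_join_def in_carrier_iff le_iff PiE_iff G.join_left G.join_right)
  show "kite_join I0 I1 lam G a b \<sqsubseteq>\<^bsub>K\<^esub> c" if "c \<in> Upper K {a, b}" for c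
  proof -
    obtain l z where [simp]: "c = (l, z)"
      by (metis surj_pair)
    have "a \<sqsubseteq>\<^bsub>K\<^esub> c" "b \<sqsubseteq>\<^bsub>K\<^esub> c" "c \<in> carrier K"
      using that assms by (auto simp: Upper_def)
    then show ?thesis
      using assms by (auto simp: kite_join_def in_carrier_iff le_iff PiE_iff G.join_le)
  qed
qed (use assms kite_join_closed in auto)

lemma kite_meet_is_glb:
  assumes "a \<in> carrier K" and "b \<in> carrier K"
  shows "greatest K (kite_meet I0 I1 lam G a b) (Lower K {a, b})"
proof (rule greatest_LowerI)
  obtain m x n y where [simp]: "a = (m, x)" "b = (n, y)"
    by (metis surj_pair)
  show "kite_meet I0 I1 lam G a b \<sqsubseteq>\<^bsub>K\<^esub> c" if "c \<in> {a, b}" for c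
    using that assms
    by (auto simp: kite_meet_def in_carrier_iff le_iff PiE_iff G.meet_left G.meet_right)
  show "c \<sqsubseteq>\<^bsub>K\<^esub> kite_meet I0 I1 lam G a b" if "c \<in> Lower K {a, b}" for c
  proof -
    obtain l z where [simp]: "c = (l, z)"
      by (metis surj_pair)
    have "c \<sqsubseteq>\<^bsub>K\<^esub> a" "c \<sqsubseteq>\<^bsub>K\<^esub> b" "c \<in> carrier K"
      using that assms by (auto simp: Lower_def)
    then show ?thesis
      using assms by (auto simp: kite_meet_def in_carrier_iff le_iff PiE_iff G.meet_le)
  qed
qed (use assms kite_meet_closed in auto)

lemma lattice: "lattice K"
proof -
  interpret partial_order K
    by (rule partial_order)
  show ?thesis
    by unfold_locales (use kite_join_is_lub kite_meet_is_glb in blast)+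
qed

lemma join_eq:
  assumes "a \<in> carrier K" and "b \<in> carrier K"
  shows "a \<squnion>\<^bsub>K\<^esub> b = kite_join I0 I1 lam G a b"
proof -
  interpret lattice K
    by (rule lattice)
  show ?thesis
    using kite_join_is_lub[OF assms] sup_of_two_least[OF assms] least_unique
    by (metis join_def)
qed

lemma meet_eq:
  assumes "a \<in> carrier K" and "b \<in> carrier K"
  shows "a \<sqinter>\<^bsub>K\<^esub> b = kite_meet I0 I1 lam G a b"
proof -
  interpret lattice K
    by (rule lattice)
  show ?thesis
    using kite_meet_is_glb[OF assms] inf_of_two_greatest[OF assms] greatest_unique
    by (metis meet_def)
qed

lemma kite_monoid: "monoid \<lparr>carrier = carrier K, mult = rmult K, one = runit K\<rparr>"
proof (unfold_locales, goal_cases)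
  case (1 a b)
  then show ?case
    by (cases a; cases b)
      (auto simp: in_carrier_iff kite_def kite_mult_def PiE_iff in_level_add_iff
        intro!: G.mult_closed)
next
  case (2 a b c)
  obtain l x m y n z where [simp]: "a = (l, x)" "b = (m, y)" "c = (n, z)"
    by (metis surj_pair)
  have "x ((lam ^^ m) ((lam ^^ n) i)) \<odot> y ((lam ^^ n) i) \<odot> z i =
      x ((lam ^^ (m + n)) i) \<odot> (y ((lam ^^ n) i) \<odot> z i)" if "i \<in> lev (l + m + n)" for i
    using 2 that
    by (auto simp: kite_def PiE_iff in_level_add_iff funpow_add intro!: G.mult_assoc)
  then show ?case
    by (auto simp: kite_def kite_mult_def in_level_add_iff funpow_add add.assoc
        intro!: restrict_ext)
next
  case 3
  then show ?case
    by (auto simp: kite_def kite_unit_def G.unit_closed)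
next
  case (4 a)
  then show ?case
    by (cases a)
      (auto simp: kite_def kite_mult_def kite_unit_def PiE_iff G.unit_mult funpow_in_base
        extensional_def restrict_def)
next
  case (5 a)
  then show ?case
    by (cases a)
      (auto simp: kite_def kite_mult_def kite_unit_def PiE_iff G.mult_unit in_level_iff
        extensional_def restrict_def fun_eq_iff)
qed

lemma kite_unit_closed: "kite_unit I0 G \<in> carrier K"
  by (auto simp: kite_def kite_unit_def G.unit_closed)

lemma le_kite_unit: "a \<in> carrier K \<Longrightarrow> a \<sqsubseteq>\<^bsub>K\<^esub> kite_unit I0 G"
  by (cases a) (auto simp: kite_unit_def le_iff in_carrier_iff PiE_iff G.integral)

lemma kite_ldiv_closed:
  assumes "a \<in> carrier K" and "c \<in> carrier K"
  shows "ldiv K a c \<in> carrier K"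
proof -
  obtain m x p z where [simp]: "a = (m, x)" "c = (p, z)"
    by (metis surj_pair)
  show ?thesis
    using assms kite_unit_closed funpow_in_level_diff[of "p - m" p]
    by (auto simp: kite_def kite_ldiv_def PiE_iff G.unit_closed intro!: G.ldiv_closed)
qed

lemma kite_rdiv_closed:
  assumes "c \<in> carrier K" and "b \<in> carrier K"
  shows "rdiv K c b \<in> carrier K"
proof -
  obtain n y p z where [simp]: "b = (n, y)" "c = (p, z)"
    by (metis surj_pair)
  show ?thesis
  proof (cases "p < n")
    case True
    then show ?thesis
      using kite_unit_closed by (simp add: kite_def kite_rdiv_def)
  next
    case False
    then have np: "n \<le> p"
      by simp
    show ?thesis
      using assms np level_antimono[OF np] inv_into_funpow[OF np]
      by (auto simp: kite_def kite_rdiv_def PiE_iff G.unit_closed intro!: G.rdiv_closed)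
  qed
qed

text \<open>
  If $p < m$, both sides hold: the product lies in a layer below that of \<open>c\<close>, and the quotient is
  the greatest element. If $m \le p \neq m + n$, both sides are decided by comparing $m + n$ with
  \<open>p\<close>. Only $p = m + n$ involves the coordinates.
\<close>

lemma kite_residuation_left:
  assumes "a \<in> carrier K" and "b \<in> carrier K" and "c \<in> carrier K"
  shows "a \<odot>\<^bsub>K\<^esub> b \<sqsubseteq>\<^bsub>K\<^esub> c \<longleftrightarrow> b \<sqsubseteq>\<^bsub>K\<^esub> ldiv K a c"
proof -
  obtain m x n y p z where [simp]: "a = (m, x)" "b = (n, y)" "c = (p, z)"
    by (metis surj_pair)
  have mult: "(m, x) \<odot>\<^bsub>K\<^esub> (n, y) = (m + n, \<lambda>i\<in>lev (m + n). x ((lam ^^ n) i) \<odot> y i)"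
    by (simp add: kite_def kite_mult_def)
  consider "p < m" | "m \<le> p" "p \<noteq> m + n" | "p = m + n"
    by linarith
  then show ?thesis
  proof cases
    case 1
    then have "ldiv K a c = kite_unit I0 G"
      by (simp add: kite_def kite_ldiv_def)
    then show ?thesis
      using 1 le_kite_unit[OF assms(2)] by (simp add: mult le_iff)
  next
    case 2
    then show ?thesis
      by (auto simp: mult le_iff) (auto simp: kite_def kite_ldiv_def kite_le_def)
  next
    case 3
    have carr: "x ((lam ^^ n) i) \<in> carrier G" "y i \<in> carrier G" "z i \<in> carrier G"
      if "i \<in> lev p" for i
      using that assms by (auto simp: 3 in_carrier_iff in_level_add_iff)
    have "a \<odot>\<^bsub>K\<^esub> b \<sqsubseteq>\<^bsub>K\<^esub> c \<longleftrightarrow> (\<forall>i\<in>lev p. x ((lam ^^ n) i) \<odot> y i \<sqsubseteq> z i)"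
      by (simp add: mult le_iff 3)
    also have "\<dots> \<longleftrightarrow> (\<forall>i\<in>lev p. y i \<sqsubseteq> ldiv G (x ((lam ^^ n) i)) (z i))"
      using carr by (simp add: G.residuation_left)
    \<comment> \<open>The coordinates in $I_n$ outside $I_p$ impose nothing, as every element is below the unit.\<close>
    also have "\<dots> \<longleftrightarrow> (\<forall>i\<in>lev n. y i \<sqsubseteq>
        (if i \<in> lev p then ldiv G (x ((lam ^^ n) i)) (z i) else runit G))"
      using assms level_antimono[of n p] 3 by (auto simp: in_carrier_iff PiE_iff G.integral)
    also have "\<dots> \<longleftrightarrow> b \<sqsubseteq>\<^bsub>K\<^esub> ldiv K a c"
      using 3 by (simp add: le_iff) (simp add: kite_def kite_ldiv_def kite_le_def)
    finally show ?thesis .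
  qed
qed

text \<open>
  The layers are compared as for the left division. In the case $p = m + n$ the coordinates must
  be reindexed along $\lambda^n$, which maps $I_p$ injectively into $I_m$.
\<close>

lemma kite_residuation_right:
  assumes "a \<in> carrier K" and "b \<in> carrier K" and "c \<in> carrier K"
  shows "a \<odot>\<^bsub>K\<^esub> b \<sqsubseteq>\<^bsub>K\<^esub> c \<longleftrightarrow> a \<sqsubseteq>\<^bsub>K\<^esub> rdiv K c b"
proof -
  obtain m x n y p z where [simp]: "a = (m, x)" "b = (n, y)" "c = (p, z)"
    by (metis surj_pair)
  have mult: "(m, x) \<odot>\<^bsub>K\<^esub> (n, y) = (m + n, \<lambda>i\<in>lev (m + n). x ((lam ^^ n) i) \<odot> y i)"
    by (simp add: kite_def kite_mult_def)
  consider "p < n" | "n \<le> p" "p \<noteq> m + n" | "p = m + n"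
    by linarith
  then show ?thesis
  proof cases
    case 1
    then have "rdiv K c b = kite_unit I0 G"
      by (simp add: kite_def kite_rdiv_def)
    then show ?thesis
      using 1 le_kite_unit[OF assms(1)] by (simp add: mult le_iff)
  next
    case 2
    then show ?thesis
      by (auto simp: mult le_iff) (auto simp: kite_def kite_rdiv_def kite_le_def)
  next
    case 3
    define q where "q = inv_into (lev n) (lam ^^ n)"
    have q: "q ((lam ^^ n) i) = i" if "i \<in> lev p" for i
      unfolding q_def using that 3 by (intro inv_into_funpow[of n p]) auto
    have carr: "x ((lam ^^ n) i) \<in> carrier G" "y i \<in> carrier G" "z i \<in> carrier G"
      and image: "(lam ^^ n) i \<in> lev m"
      if "i \<in> lev p" for i
      using that assms by (auto simp: 3 in_carrier_iff in_level_add_iff)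
    have "a \<odot>\<^bsub>K\<^esub> b \<sqsubseteq>\<^bsub>K\<^esub> c \<longleftrightarrow> (\<forall>i\<in>lev p. x ((lam ^^ n) i) \<odot> y i \<sqsubseteq> z i)"
      by (simp add: mult le_iff 3)
    also have "\<dots> \<longleftrightarrow> (\<forall>i\<in>lev p. x ((lam ^^ n) i) \<sqsubseteq> rdiv G (z i) (y i))"
      using carr by (simp add: G.residuation_right)
    \<comment> \<open>Substitute $j = \lambda^n(i)$; the remaining $j \in I_m$ impose nothing by integrality.\<close>
    also have "\<dots> \<longleftrightarrow> (\<forall>j\<in>lev m. x j \<sqsubseteq>
        (if j \<in> (lam ^^ n) ` lev p then rdiv G (z (q j)) (y (q j)) else runit G))"
      using assms image by (auto simp: in_carrier_iff PiE_iff G.integral q)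
    also have "\<dots> \<longleftrightarrow> a \<sqsubseteq>\<^bsub>K\<^esub> rdiv K c b"
      unfolding q_def
      using 3 by (simp add: le_iff) (simp add: kite_def kite_rdiv_def kite_le_def)
    finally show ?thesis .
  qed
qed

theorem kite_residuated_lattice: "residuated_lattice K"
  by (intro residuated_lattice.intro residuated_lattice_axioms.intro lattice kite_monoid
      kite_ldiv_closed kite_rdiv_closed kite_residuation_left kite_residuation_right)

end

section \<open>Transformations of frames\<close>

context frame_transformation
begin

lemma in_domain_iff: "i \<in> I0 \<Longrightarrow> t i \<in> J1 \<longleftrightarrow> i \<in> I1"
  using vimage_domain by blast

lemma funpow_commute: "i \<in> I.lev n \<Longrightarrow> t ((lam ^^ n) i) = (kappa ^^ n) (t i)"
  by (induction n) (auto simp: I.in_level_iff commute)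

text \<open>
  The orbits of \<open>i\<close> and $t(i)$ run in parallel, and \<open>t\<close> both preserves and reflects the
  condition that one more step is possible.
\<close>

lemma in_level_iff: "i \<in> I0 \<Longrightarrow> t i \<in> J.lev n \<longleftrightarrow> i \<in> I.lev n"
proof (induction n)
  case 0
  then show ?case
    using maps by auto
next
  case (Suc n)
  have "t i \<in> J.lev (1 + n) \<longleftrightarrow> i \<in> I.lev n \<and> (kappa ^^ n) (t i) \<in> J1"
    unfolding J.in_level_add_iff using Suc by simp
  also have "\<dots> \<longleftrightarrow> i \<in> I.lev n \<and> (lam ^^ n) i \<in> I1"
    using in_domain_iff I.funpow_in_base funpow_commute by metis
  also have "\<dots> \<longleftrightarrow> i \<in> I.lev (1 + n)"
    unfolding I.in_level_add_iff by simp
  finally show ?case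
    by simp
qed

lemma level_maps: "i \<in> I.lev n \<Longrightarrow> t i \<in> J.lev n"
  using in_level_iff by (auto simp: I.in_level_iff)

text \<open>
  One backward step: if $t(i) = \kappa(j')$, the condition on images gives $i = \lambda(l)$ for some
  $l \in I_1$, so that $\kappa(t(l)) = t(i) = \kappa(j')$ and $t(l) = j'$ by injectivity of
  \<open>\<kappa>\<close>. The construction then continues from \<open>l\<close> and \<open>j'\<close>.
\<close>

lemma lift_funpow_preimage:
  assumes "i \<in> I0" and "j \<in> J.lev n" and "t i = (kappa ^^ n) j"
  shows "\<exists>i'\<in>I.lev n. (lam ^^ n) i' = i \<and> t i' = j"
  using assms
proof (induction n arbitrary: i)
  case 0
  then show ?case
    by simp
next
  case (Suc n)
  define j' where "j' = (kappa ^^ n) j"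
  have j: "j \<in> J.lev n" "j' \<in> J1" and ti: "t i = kappa j'"
    using Suc.prems by (auto simp: J.in_level_iff j'_def)
  then have "i \<in> lam ` I1"
    using Suc.prems(1) vimage_image by blast
  then obtain l where l: "l \<in> I1" "lam l = i"
    by blast
  then have l0: "l \<in> I0"
    using I.subset by blast
  have "t l = j'"
    using l l0 j(2) ti J.inj in_domain_iff commute[of l] by (metis inj_onD)
  then obtain i' where i': "i' \<in> I.lev n" "(lam ^^ n) i' = l" "t i' = j"
    using Suc.IH[OF l0 j(1)] by (auto simp: j'_def)
  then have "i' \<in> I.lev (1 + n)"
    unfolding I.in_level_add_iff using l by simp
  then show ?case
    using i' l by auto
qed

lemma in_funpow_image_iff:
  assumes "i \<in> I0" and "m \<le> n"
  shows "t i \<in> (kappa ^^ m) ` J.lev n \<longleftrightarrow> i \<in> (lam ^^ m) ` I.lev n"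
proof
  assume "t i \<in> (kappa ^^ m) ` J.lev n"
  then obtain j where j: "j \<in> J.lev n" "t i = (kappa ^^ m) j"
    by blast
  then obtain i' where i': "i' \<in> I.lev m" "(lam ^^ m) i' = i" "t i' = j"
    using lift_funpow_preimage[of i j m] assms J.level_antimono by blast
  then have "i' \<in> I.lev n"
    using j in_level_iff[of i' n] by (simp add: I.in_level_iff)
  then show "i \<in> (lam ^^ m) ` I.lev n"
    using i' by blast
next
  assume "i \<in> (lam ^^ m) ` I.lev n"
  then show "t i \<in> (kappa ^^ m) ` J.lev n"
    using level_maps I.level_antimono[OF assms(2)] by (force simp: funpow_commute)
qed

end

section \<open>The induced homomorphism\<close>

locale kite_transformation =
  frame_transformation I0 I1 lam J0 J1 kappa t + G: integral_residuated_lattice G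
  for I0 :: "'i set" and I1 lam and J0 :: "'j set" and J1 kappa t
    and G :: "('a, 'c) residuated_scheme" (structure)
begin

sublocale KI: kite_of_frame I0 I1 lam G ..

sublocale KJ: kite_of_frame J0 J1 kappa G ..

abbreviation h :: "nat \<times> ('j \<Rightarrow> 'a) \<Rightarrow> nat \<times> ('i \<Rightarrow> 'a)" where
  "h \<equiv> kite_map I0 I1 lam t"

lemma map_closed: "a \<in> carrier KJ.K \<Longrightarrow> h a \<in> carrier KI.K"
  by (cases a) (auto simp: kite_def kite_map_def PiE_iff level_maps)

lemma map_unit: "h (kite_unit J0 G) = kite_unit I0 G"
  using maps by (auto simp: kite_map_def kite_unit_def intro!: restrict_ext)

lemma map_meet: "h (kite_meet J0 J1 kappa G a b) = kite_meet I0 I1 lam G (h a) (h b)"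
  by (cases a; cases b) (auto simp: kite_map_def kite_meet_def level_maps)

lemma map_join: "h (kite_join J0 J1 kappa G a b) = kite_join I0 I1 lam G (h a) (h b)"
  by (cases a; cases b) (auto simp: kite_map_def kite_join_def level_maps)

lemma map_mult: "h (kite_mult J0 J1 kappa G a b) = kite_mult I0 I1 lam G (h a) (h b)"
proof -
  obtain m x n y where [simp]: "a = (m, x)" "b = (n, y)"
    by (metis surj_pair)
  have "i \<in> I.lev (m + n) \<Longrightarrow> t i \<in> J.lev (m + n) \<and> i \<in> I.lev n \<and> (lam ^^ n) i \<in> I.lev m \<and>
      t ((lam ^^ n) i) = (kappa ^^ n) (t i)" for i
    using I.in_level_add_iff level_maps funpow_commute by blast
  then show ?thesis
    by (auto simp: kite_map_def kite_mult_def intro!: restrict_ext)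
qed

lemma map_ldiv: "h (kite_ldiv J0 J1 kappa G a b) = kite_ldiv I0 I1 lam G (h a) (h b)"
proof -
  obtain m x n y where [simp]: "a = (m, x)" "b = (n, y)"
    by (metis surj_pair)
  show ?thesis
  proof (cases "n < m")
    case True
    then show ?thesis
      using map_unit by (simp add: kite_ldiv_def) (simp add: kite_map_def)
  next
    case False
    have "t i \<in> J.lev (n - m) \<and> (t i \<in> J.lev n \<longleftrightarrow> i \<in> I.lev n) \<and>
        t ((lam ^^ (n - m)) i) = (kappa ^^ (n - m)) (t i)" if "i \<in> I.lev (n - m)" for i
      using that level_maps funpow_commute in_level_iff by (auto simp: I.in_level_iff)
    moreover have "(lam ^^ (n - m)) i \<in> I.lev m" if "i \<in> I.lev n" for i
      using that False I.funpow_in_level_diff[of "n - m" n i] by simp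
    ultimately show ?thesis
      using False by (auto simp: kite_map_def kite_ldiv_def intro!: restrict_ext)
  qed
qed

text \<open>
  Both kites use the unit at the same coordinates by \<open>in_funpow_image_iff\<close>, and at the other
  ones $\kappa^{-m}(t(i)) = t(\lambda^{-m}(i))$ because \<open>t\<close> commutes with the iterates and these
  are injective.
\<close>

lemma map_rdiv: "h (kite_rdiv J0 J1 kappa G b a) = kite_rdiv I0 I1 lam G (h b) (h a)"
proof -
  obtain m x n y where [simp]: "a = (m, x)" "b = (n, y)"
    by (metis surj_pair)
  show ?thesis
  proof (cases "n < m")
    case True
    then show ?thesis
      using map_unit by (simp add: kite_rdiv_def) (simp add: kite_map_def)
  next
    case False
    then have mn: "m \<le> n"
      by simp
    have iff: "t i \<in> J.lev (n - m) \<and>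
        (t i \<in> (kappa ^^ m) ` J.lev n \<longleftrightarrow> i \<in> (lam ^^ m) ` I.lev n)"
      if "i \<in> I.lev (n - m)" for i
      using that level_maps in_funpow_image_iff[OF _ mn] by (auto simp: I.in_level_iff)
    have inverse: "inv_into (I.lev m) (lam ^^ m) ((lam ^^ m) k) = k"
      "inv_into (J.lev m) (kappa ^^ m) (t ((lam ^^ m) k)) = t k" "k \<in> I.lev m"
      if "k \<in> I.lev n" for k
      using that mn I.inv_into_funpow[OF mn] J.inv_into_funpow[OF mn] level_maps
        I.level_antimono[OF mn] funpow_commute by (auto simp: subset_iff)
    then have "inv_into (J.lev m) (kappa ^^ m) (t i) = t (inv_into (I.lev m) (lam ^^ m) i) \<and>
        inv_into (I.lev m) (lam ^^ m) i \<in> I.lev n \<inter> I.lev m" if "i \<in> (lam ^^ m) ` I.lev n" for i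
      using that by auto
    then show ?thesis
      using False iff by (auto simp: kite_map_def kite_rdiv_def intro!: restrict_ext)
  qed
qed

end

theorem theorem7p6:
  fixes I0 I1 :: "'i set" and lam :: "'i \<Rightarrow> 'i"
    and J0 J1 :: "'j set" and kappa :: "'j \<Rightarrow> 'j"
    and t :: "'i \<Rightarrow> 'j"
    and G :: "('a, 'c) residuated_scheme"
  assumes "frame_transformation I0 I1 lam J0 J1 kappa t"
    and "integral_residuated_lattice G"
  shows "residuated_lattice_hom (kite J0 J1 kappa G) (kite I0 I1 lam G)
           (kite_map I0 I1 lam t)"
proof -
  interpret kite_transformation I0 I1 lam J0 J1 kappa t G
    using assms by (rule kite_transformation.intro)
  show ?thesis
  proof (intro residuated_lattice_hom.intro residuated_lattice_hom_axioms.intro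
      KI.kite_residuated_lattice KJ.kite_residuated_lattice)
    fix a b assume ab: "a \<in> carrier KJ.K" "b \<in> carrier KJ.K"
    show "h (a \<sqinter>\<^bsub>KJ.K\<^esub> b) = h a \<sqinter>\<^bsub>KI.K\<^esub> h b"
      using ab by (simp add: KI.meet_eq KJ.meet_eq map_closed map_meet)
    show "h (a \<squnion>\<^bsub>KJ.K\<^esub> b) = h a \<squnion>\<^bsub>KI.K\<^esub> h b"
      using ab by (simp add: KI.join_eq KJ.join_eq map_closed map_join)
  qed (use map_closed in \<open>auto simp: kite_def map_unit map_mult map_ldiv map_rdiv\<close>)
qed

end
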